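(* The bilinear product $\sharp:\tilde V\otimes\tilde V\longrightarrow\tilde V$ defined by $$(t,s)\,\sharp\,(t',s')=\begin{cases}(t,s\cup s')&\text{if } t'=t/s,\\ 0&\text{if not}\end{cases}$$ is associative.
   Context: Work over a fixed base field. A rooted tree is a finite connected simply connected oriented graph in which every vertex has exactly one incoming edge, except a distinguished vertex (the root) which has none. A subforest $s$ of a tree $t$ is a (possibly empty) collection of pairwise vertex-disjoint subtrees of $t$, and $t/s$ is the tree obtained from $t$ by contracting each connected component of $s$ onto a vertex. $\tilde V$ is the vector space with basis the couples $(t,s)$ with $t$ a rooted tree and $s$ a subforest of $t$ (the couple of empty forests is allowed). Trees are regarded as actual graphs (taken from a fixed set of trees closed under contraction) and $s$ as an actual subgraph of $t$; the edges of $t/s$ are identified with the edges of $t$ not in $s$. The condition $t'=t/s$ means that $t'$ is the contracted tree $t/s$. In that case, $s'$ is a subforest of $t/s$ and $s\cup s'$ is the subforest of $t$ whose edges are those of $s$ and those of $s'$ (viewed as edges of $t$), and whose vertices are those of $s$ together with all vertices of $t$ mapped by the contraction $t\to t/s$ to vertices of $s'$. The trees $(t/s)/s'$ and $t/(s\cup s')$ are identified canonically. *)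

theory Defs
  imports "Graph_Theory.Graph_Theory" "HOL-Library.Poly_Mapping" "HOL-Library.FuncSet"
begin

text \<open>
  An edge path is a list of arcs, each tagged with the direction of travel (\<open>True\<close>: along the
  orientation). A path is reduced if it never goes back at once along the arc just used. The reduced
  closed edge paths at a vertex represent the elements of the fundamental group, so that
  \<open>simply_connected\<close> says that all fundamental groups are trivial; connectedness is a separate
  condition.
\<close>

fun edge_path :: "('v, 'e) pre_digraph \<Rightarrow> 'v \<Rightarrow> ('e \<times> bool) list \<Rightarrow> 'v \<Rightarrow> bool" where
  "edge_path G u [] v \<longleftrightarrow> u = v \<and> u \<in> verts G"
| "edge_path G u ((e, d) # p) v \<longleftrightarrow>
     e \<in> arcs G \<and> u = (if d then tail G e else head G e) \<and>
     edge_path G (if d then head G e else tail G e) p v"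

definition reduced :: "('e \<times> bool) list \<Rightarrow> bool" where
  "reduced p \<longleftrightarrow> successively (\<lambda>x y. y \<noteq> (fst x, \<not> snd x)) p"

definition simply_connected :: "('v, 'e) pre_digraph \<Rightarrow> bool" where
  "simply_connected G \<longleftrightarrow> (\<forall>u p. edge_path G u p u \<and> reduced p \<longrightarrow> p = [])"

definition rooted_tree :: "('v, 'e) pre_digraph \<Rightarrow> bool" where
  "rooted_tree t \<longleftrightarrow> fin_digraph t \<and> connected t \<and> simply_connected t \<and>
     (\<exists>r\<in>verts t. in_degree t r = 0 \<and> (\<forall>v\<in>verts t - {r}. in_degree t v = 1))"

definition subtree :: "('v, 'e) pre_digraph \<Rightarrow> ('v, 'e) pre_digraph \<Rightarrow> bool" where
  "subtree c t \<longleftrightarrow> subgraph c t \<and> rooted_tree c"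

text \<open>
  A subforest is identified with the subgraph formed by its trees. Trees reduced to a single vertex
  are allowed, and two trees of a subforest may be joined by an arc of \<open>t\<close> outside the subforest.
\<close>

definition subforest :: "('v, 'e) pre_digraph \<Rightarrow> ('v, 'e) pre_digraph \<Rightarrow> bool" where
  "subforest s t \<longleftrightarrow> (\<exists>C. (\<forall>c\<in>C. subtree c t) \<and>
     (\<forall>c\<in>C. \<forall>d\<in>C. c \<noteq> d \<longrightarrow> verts c \<inter> verts d = {}) \<and> s = pre_digraph.Union t C)"

text \<open>
  The vertex onto which a connected component of \<open>s\<close> is contracted is named by the root of that
  component, and the arcs outside \<open>s\<close> keep their identity. With this choice the canonical
  identification of \<open>(t/s)/s'\<close> with \<open>t/(s \<union> s')\<close> is an equality.
\<close>

definition contraction_map :: "('v, 'e) pre_digraph \<Rightarrow> 'v \<Rightarrow> 'v" where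
  "contraction_map s v =
     (if v \<in> verts s
      then THE r. r \<in> verts s \<and> in_degree s r = 0 \<and> v \<rightarrow>\<^sup>*\<^bsub>with_proj (mk_symmetric s)\<^esub> r
      else v)"

definition contract :: "('v, 'e) pre_digraph \<Rightarrow> ('v, 'e) pre_digraph \<Rightarrow> ('v, 'e) pre_digraph" where
  "contract t s =
     \<lparr> verts = contraction_map s ` verts t,
       arcs = arcs t - arcs s,
       tail = restrict (\<lambda>e. contraction_map s (tail t e)) (arcs t - arcs s),
       head = restrict (\<lambda>e. contraction_map s (head t e)) (arcs t - arcs s) \<rparr>"

text \<open>The subforest \<open>s \<union> s'\<close> of \<open>t\<close>, for \<open>s\<close> a subforest of \<open>t\<close> and \<open>s'\<close> one of \<open>t/s\<close>.\<close>

definition forest_union ::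
  "('v, 'e) pre_digraph \<Rightarrow> ('v, 'e) pre_digraph \<Rightarrow> ('v, 'e) pre_digraph \<Rightarrow> ('v, 'e) pre_digraph" where
  "forest_union t s s' =
     \<lparr> verts = verts s \<union> {v \<in> verts t. contraction_map s v \<in> verts s'},
       arcs = arcs s \<union> arcs s',
       tail = tail t,
       head = head t \<rparr>"

text \<open>
  The functions \<open>tail\<close> and \<open>head\<close> are total. Fixing their values outside the set of arcs makes
  equality of records the same as equality of graphs.
\<close>

definition extensional_graph :: "('v, 'e) pre_digraph \<Rightarrow> bool" where
  "extensional_graph G \<longleftrightarrow> tail G \<in> extensional (arcs G) \<and> head G \<in> extensional (arcs G)"

definition contraction_closed :: "('v, 'e) pre_digraph set \<Rightarrow> bool" where
  "contraction_closed T \<longleftrightarrow>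
     (\<forall>t\<in>T. rooted_tree t \<and> extensional_graph t) \<and>
     (\<forall>t\<in>T. \<forall>s. subforest s t \<longrightarrow> contract t s \<in> T)"

definition empty_graph :: "('v, 'e) pre_digraph" where
  "empty_graph = \<lparr> verts = {}, arcs = {}, tail = (\<lambda>_. undefined), head = (\<lambda>_. undefined) \<rparr>"

type_synonym ('v, 'e) couple = "('v, 'e) pre_digraph \<times> ('v, 'e) pre_digraph"

text \<open>The empty graph contributes exactly one couple, the couple of empty forests.\<close>

definition couples :: "('v, 'e) pre_digraph set \<Rightarrow> ('v, 'e) couple set" where
  "couples T = {(t, s). (t \<in> T \<or> t = empty_graph) \<and> subforest s t}"

text \<open>The vector space with basis \<open>couples T\<close>, as finitely supported functions.\<close>

definition V_tilde :: "('v, 'e) pre_digraph set \<Rightarrow> (('v, 'e) couple \<Rightarrow>\<^sub>0 'k::field) set" where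
  "V_tilde T = {x. Poly_Mapping.keys x \<subseteq> couples T}"

definition sharp_basis :: "('v, 'e) couple \<Rightarrow> ('v, 'e) couple \<Rightarrow> 'k \<Rightarrow> (('v, 'e) couple \<Rightarrow>\<^sub>0 'k::field)" where
  "sharp_basis a b k =
     (case (a, b) of ((t, s), (t', s')) \<Rightarrow>
        if t' = contract t s then Poly_Mapping.single (t, forest_union t s s') k else 0)"

definition sharp ::
  "(('v, 'e) couple \<Rightarrow>\<^sub>0 'k::field) \<Rightarrow> (('v, 'e) couple \<Rightarrow>\<^sub>0 'k) \<Rightarrow> (('v, 'e) couple \<Rightarrow>\<^sub>0 'k)"
  (infixl \<open>\<sharp>\<close> 70) where
  "x \<sharp> y = (\<Sum>a\<in>Poly_Mapping.keys x. \<Sum>b\<in>Poly_Mapping.keys y.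
      sharp_basis a b (Poly_Mapping.lookup x a * Poly_Mapping.lookup y b))"

text \<open>The product is the bilinear map with the prescribed values on the basis.\<close>

lemma sharp_basis_zero [simp]: "sharp_basis a b 0 = 0"
  by (simp add: sharp_basis_def split: prod.split)

lemma sharp_basis_add: "sharp_basis a b (k + l) = sharp_basis a b k + sharp_basis a b l"
  by (simp add: sharp_basis_def single_add split: prod.split)

lemma sharp_basis_scale:
  "sharp_basis a b (c * k) = Poly_Mapping.map ((*) c) (sharp_basis a b k)"
  by (auto simp: sharp_basis_def map.rep_eq lookup_single when_def
      intro!: poly_mapping_eqI split: prod.split)

lemma sharp_on_basis:
  "Poly_Mapping.single (t, s) 1 \<sharp> Poly_Mapping.single (t', s') 1 =
     (if t' = contract t s then Poly_Mapping.single (t, forest_union t s s') 1 else 0)"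
  by (simp add: sharp_def sharp_basis_def)

lemma sharp_superset:
  assumes "finite A" "Poly_Mapping.keys x \<subseteq> A" "finite B" "Poly_Mapping.keys y \<subseteq> B"
  shows "x \<sharp> y = (\<Sum>a\<in>A. \<Sum>b\<in>B.
    sharp_basis a b (Poly_Mapping.lookup x a * Poly_Mapping.lookup y b))"
proof -
  have "x \<sharp> y = (\<Sum>a\<in>Poly_Mapping.keys x. \<Sum>b\<in>B.
      sharp_basis a b (Poly_Mapping.lookup x a * Poly_Mapping.lookup y b))"
    unfolding sharp_def
    by (intro sum.cong sum.mono_neutral_left refl) (use assms in \<open>auto simp: in_keys_iff\<close>)
  also have "\<dots> = (\<Sum>a\<in>A. \<Sum>b\<in>B.
      sharp_basis a b (Poly_Mapping.lookup x a * Poly_Mapping.lookup y b))"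
    by (intro sum.mono_neutral_left) (use assms in \<open>auto simp: in_keys_iff\<close>)
  finally show ?thesis .
qed

lemma sharp_add_left: "(x + y) \<sharp> z = x \<sharp> z + y \<sharp> z"
proof -
  let ?A = "Poly_Mapping.keys x \<union> Poly_Mapping.keys y"
  have "Poly_Mapping.keys (x + y) \<subseteq> ?A"
    by (rule Poly_Mapping.keys_add)
  then show ?thesis
    by (simp add: sharp_superset[where A = ?A and B = "Poly_Mapping.keys z"]
        lookup_add distrib_right sharp_basis_add sum.distrib)
qed

lemma sharp_add_right: "x \<sharp> (y + z) = x \<sharp> y + x \<sharp> z"
proof -
  let ?B = "Poly_Mapping.keys y \<union> Poly_Mapping.keys z"
  have "Poly_Mapping.keys (y + z) \<subseteq> ?B"
    by (rule Poly_Mapping.keys_add)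
  then show ?thesis
    by (simp add: sharp_superset[where A = "Poly_Mapping.keys x" and B = ?B]
        lookup_add distrib_left sharp_basis_add sum.distrib)
qed

lemma keys_scale: "Poly_Mapping.keys (Poly_Mapping.map ((*) c) x) \<subseteq> Poly_Mapping.keys x"
  for c :: "'k::field"
  by (auto simp: in_keys_iff map.rep_eq when_def)

lemma lookup_scale:
  "Poly_Mapping.lookup (Poly_Mapping.map ((*) c) x) a = c * Poly_Mapping.lookup x a"
  for c :: "'k::field"
  by (simp add: map.rep_eq when_def)

lemma scale_sum:
  "Poly_Mapping.map ((*) c) (sum f A) = (\<Sum>a\<in>A. Poly_Mapping.map ((*) c) (f a))"
  for c :: "'k::field"
  by (rule poly_mapping_eqI) (simp add: lookup_scale lookup_sum sum_distrib_left)

lemma sharp_scale_left: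
  "Poly_Mapping.map ((*) c) x \<sharp> y = Poly_Mapping.map ((*) c) (x \<sharp> y)"
  using keys_scale[of c x]
  by (simp add: sharp_superset[where A = "Poly_Mapping.keys x" and B = "Poly_Mapping.keys y"]
      lookup_scale scale_sum mult.assoc flip: sharp_basis_scale)

lemma sharp_scale_right:
  "x \<sharp> Poly_Mapping.map ((*) c) y = Poly_Mapping.map ((*) c) (x \<sharp> y)"
  using keys_scale[of c y]
  by (simp add: sharp_superset[where A = "Poly_Mapping.keys x" and B = "Poly_Mapping.keys y"]
      lookup_scale scale_sum mult.left_commute flip: sharp_basis_scale)

end

theory Submission
  imports Defs
begin

text \<open>
  On basis elements both ways of bracketing \<open>(t, s) \<sharp> (t', s') \<sharp> (t'', s'')\<close> vanish unless
  \<open>t' = t/s\<close>. If \<open>t' = t/s\<close>, the left bracketing is nonzero exactly when \<open>t'' = t/(s \<union> s')\<close> and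
  the right one exactly when \<open>t'' = (t/s)/s'\<close>. So associativity rests on the identity
  \<open>(t/s)/s' = t/(s \<union> s')\<close> (\<open>contract_contract\<close>) and on the associativity of the union
  (\<open>forest_union_assoc\<close>). Both follow from one fact about the naming of contracted vertices: the
  contraction map of \<open>s \<union> s'\<close> is the composition of those of \<open>s\<close> and \<open>s'\<close>
  (\<open>contraction_map_forest_union\<close>).

  That fact is proved through a universal property. The contraction map of a forest fixes every
  vertex without an incoming arc and takes the same value at both ends of an arc, and since every
  vertex of a finite forest is reached from a root by descending along arcs, these two properties
  determine it (\<open>contraction_map_eqI\<close>). The composed map is constant along the arcs of \<open>s\<close> and along
  those of \<open>s'\<close>. It fixes the roots of \<open>s \<union> s'\<close> because an arc of \<open>s'\<close> that enters the contracted
  vertex \<open>r\<close> in \<open>t/s\<close> must enter \<open>r\<close> itself in \<open>t\<close>: every other vertex of the component of \<open>r\<close>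
  already has its only incoming arc in \<open>s\<close>.

  That \<open>s \<union> s'\<close> is again a subforest of \<open>t\<close>, so that the product stays inside the space, becomes a
  check of end points once one knows that every subgraph of a tree is a subforest
  (\<open>subforest_iff_subgraph\<close>): its connected components are trees.
\<close>

section \<open>Rooted forests\<close>

text \<open>
  Unlike \<open>rooted_tree\<close>, these conditions pass to arbitrary subgraphs, and they hold for the empty
  graph. That no path climbs forever from child to parent replaces the existence of a root above
  each vertex, and gives induction from the roots downwards.
\<close>

locale rooted_forest = fin_digraph G for G :: "('v, 'e) pre_digraph" +
  assumes parent_arc_unique:
      "\<lbrakk>e \<in> arcs G; e' \<in> arcs G; head G e = head G e'\<rbrakk> \<Longrightarrow> e = e'"
    and wf_arcs_ends: "wf (arcs_ends G)"
    and simply_connected: "simply_connected G"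

text \<open>
  The accessible part of the arc relation contains the root and is closed under neighbours: it is
  closed downwards along arcs because a vertex has no other predecessor than its parent, and upwards
  by the definition of accessibility. By connectedness it contains all vertices.
\<close>

lemma rooted_forest_if_rooted_tree:
  assumes "rooted_tree t"
  shows "rooted_forest t"
proof -
  from assms interpret fin_digraph t by (simp add: rooted_tree_def)
  obtain r where r: "r \<in> verts t" "in_degree t r = 0"
    and nonroot: "\<And>v. v \<in> verts t \<Longrightarrow> v \<noteq> r \<Longrightarrow> in_degree t v = 1"
    using assms by (auto simp: rooted_tree_def)
  have no_arc_to_root: "head t e \<noteq> r" if "e \<in> arcs t" for e
    using r that finite_in_arcs[of r] by (auto simp: in_degree_def in_arcs_def)
  have unique: "e = e'" if "e \<in> arcs t" "e' \<in> arcs t" "head t e = head t e'" for e e'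
  proof -
    have "in_degree t (head t e) = 1"
      using nonroot no_arc_to_root that by simp
    then obtain a where "in_arcs t (head t e) = {a}"
      unfolding in_degree_def by (rule card_1_singletonE)
    then show ?thesis
      using that by (simp add: in_arcs_def set_eq_iff) metis
  qed
  have acc: "v \<in> Wellfounded.acc (arcs_ends t)" if "v \<in> verts t" for v
  proof -
    have "r \<rightarrow>\<^sup>*\<^bsub>with_proj (mk_symmetric t)\<^esub> v"
      using assms that r(1) by (auto simp: rooted_tree_def connected_def strongly_connected_def)
    then have "(r, v) \<in> rtrancl_on (verts t) (parcs (mk_symmetric t))"
      by (simp add: reachable_def)
    then show ?thesis
    proof (induction rule: rtrancl_on_induct)
      case base
      show ?case
        by (rule accI) (use no_arc_to_root in \<open>auto simp: arcs_ends_conv\<close>)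
    next
      case (step y z)
      then obtain e where e: "e \<in> arcs t"
        and "y = tail t e \<and> z = head t e \<or> y = head t e \<and> z = tail t e"
        by (auto simp: parcs_mk_symmetric)
      then consider "y = tail t e" "z = head t e" | "y = head t e" "z = tail t e"
        by blast
      then show ?case
      proof cases
        case 1
        show ?thesis
        proof (rule accI)
          fix x assume "(x, z) \<in> arcs_ends t"
          then have "x = y"
            using unique e 1 by (auto simp: arcs_ends_conv)
          with step.IH show "x \<in> Wellfounded.acc (arcs_ends t)"
            by simp
        qed
      next
        case 2
        with e step.IH show ?thesis
          by (auto simp: arcs_ends_conv intro: acc_downward)
      qed
    qed
  qed
  have "wf (arcs_ends t)"
  proof (rule acc_wfI, rule allI)
    fix v
    show "v \<in> Wellfounded.acc (arcs_ends t)"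
    proof (cases "v \<in> verts t")
      case False
      show ?thesis
        by (rule accI) (use False in \<open>auto simp: arcs_ends_conv\<close>)
    qed (rule acc)
  qed
  then show ?thesis
    using assms unique by unfold_locales (auto simp: rooted_tree_def)
qed

lemma rooted_forest_empty_graph: "rooted_forest (empty_graph :: ('v, 'e) pre_digraph)"
proof -
  have "edge_path (empty_graph :: ('v, 'e) pre_digraph) u p v \<Longrightarrow> False" for u p v
    by (cases p) (auto simp: empty_graph_def)
  then show ?thesis
    by unfold_locales (auto simp: empty_graph_def arcs_ends_def simply_connected_def)
qed

lemma edge_path_supergraph:
  assumes "subgraph s t" "edge_path s u p v"
  shows "edge_path t u p v"
  using assms(2)
proof (induction p arbitrary: u)
  case Nil
  then show ?case
    using assms(1) by (auto simp: subgraph_def)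
next
  case (Cons a p)
  then show ?case
    using assms(1) by (cases a) (auto simp: subgraph_def compatible_def)
qed

lemma simply_connected_subgraph:
  assumes "subgraph s t" "simply_connected t"
  shows "simply_connected s"
  using assms(2) edge_path_supergraph[OF assms(1)] unfolding simply_connected_def by blast

lemma rooted_forest_subgraph:
  assumes "rooted_forest t" "subgraph s t"
  shows "rooted_forest s"
proof -
  interpret rooted_forest t by fact
  interpret s: wf_digraph s using assms(2) by (simp add: subgraph_def)
  have sub: "verts s \<subseteq> verts t" "arcs s \<subseteq> arcs t" "tail s = tail t" "head s = head t"
    using assms(2) by (auto simp: subgraph_def compatible_def)
  have "arcs_ends s \<subseteq> arcs_ends t"
    using sub by (auto simp: arcs_ends_conv)
  then show ?thesis
    using sub finite_subset[OF sub(1)] finite_subset[OF sub(2)] wf_subset[OF wf_arcs_ends]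
      simply_connected_subgraph[OF assms(2) simply_connected]
    by unfold_locales (auto intro: parent_arc_unique)
qed

section \<open>The contraction map\<close>

context rooted_forest
begin

lemma in_degree_eq_0_iff: "in_degree G v = 0 \<longleftrightarrow> (\<forall>e\<in>arcs G. head G e \<noteq> v)"
  using finite_in_arcs[of v] by (auto simp: in_degree_def in_arcs_def)

text \<open>
  The set of vertices below a root \<open>r\<close> is closed under neighbours in both directions, again because
  incoming arcs are unique. So a root connected to \<open>r\<close> lies below \<open>r\<close>, hence equals \<open>r\<close>.
  This makes the definite description in \<open>contraction_map\<close> meaningful.
\<close>

lemma root_of_component_unique:
  assumes "r \<in> verts G" "in_degree G r = 0" "in_degree G r' = 0"
    and "r \<rightarrow>\<^sup>*\<^bsub>with_proj (mk_symmetric G)\<^esub> r'"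
  shows "r = r'"
proof -
  have "(r, r') \<in> rtrancl_on (verts G) (parcs (mk_symmetric G))"
    using assms(4) by (simp add: reachable_def)
  then have "(r, r') \<in> (arcs_ends G)\<^sup>*"
  proof (induction rule: rtrancl_on_induct)
    case (step y z)
    then obtain e where e: "e \<in> arcs G"
      and "y = tail G e \<and> z = head G e \<or> y = head G e \<and> z = tail G e"
      by (auto simp: parcs_mk_symmetric)
    then consider "y = tail G e" "z = head G e" | "y = head G e" "z = tail G e"
      by blast
    then show ?case
    proof cases
      case 1
      with e step.IH show ?thesis
        by (auto simp: arcs_ends_conv intro: rtrancl_into_rtrancl)
    next
      case 2
      from step.IH show ?thesis
      proof (cases rule: rtranclE)
        case base
        then show ?thesis
          using 2 e assms(2) by (auto simp: in_degree_eq_0_iff)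
      next
        case (step x)
        with 2 e have "x = z"
          using parent_arc_unique by (auto simp: arcs_ends_conv)
        with step show ?thesis by simp
      qed
    qed
  qed simp
  then show ?thesis
    using assms(3) by (cases rule: rtranclE) (auto simp: arcs_ends_conv in_degree_eq_0_iff)
qed

lemma contraction_map_root:
  assumes "in_degree G v = 0"
  shows "contraction_map G v = v"
proof (cases "v \<in> verts G")
  case True
  interpret sym: pair_wf_digraph "mk_symmetric G" ..
  have "v \<rightarrow>\<^sup>*\<^bsub>with_proj (mk_symmetric G)\<^esub> v"
    using True by (simp add: reachable_def)
  with True assms have "(THE r. r \<in> verts G \<and> in_degree G r = 0 \<and>
      v \<rightarrow>\<^sup>*\<^bsub>with_proj (mk_symmetric G)\<^esub> r) = v"
    using root_of_component_unique[OF True assms] by (intro the_equality) blast+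
  with True show ?thesis
    by (simp add: contraction_map_def)
qed (simp add: contraction_map_def)

lemma contraction_map_arc:
  assumes "e \<in> arcs G"
  shows "contraction_map G (head G e) = contraction_map G (tail G e)"
proof -
  interpret sym: pair_wf_digraph "mk_symmetric G" ..
  have "(head G e, tail G e) \<in> parcs (mk_symmetric G)" "(tail G e, head G e) \<in> parcs (mk_symmetric G)"
    using assms by (auto simp: parcs_mk_symmetric)
  then have "head G e \<rightarrow>\<^sup>*\<^bsub>with_proj (mk_symmetric G)\<^esub> r \<longleftrightarrow>
      tail G e \<rightarrow>\<^sup>*\<^bsub>with_proj (mk_symmetric G)\<^esub> r" for r
    using sym.adj_reachable_trans by auto
  then show ?thesis
    using assms by (simp add: contraction_map_def)
qed

text \<open>
  The base case also covers the points that are not vertices of \<open>G\<close>, whose in-degree is \<open>0\<close>.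
\<close>

lemma forest_induct [case_names root arc]:
  assumes "\<And>r. in_degree G r = 0 \<Longrightarrow> P r"
    and "\<And>e. \<lbrakk>e \<in> arcs G; P (tail G e)\<rbrakk> \<Longrightarrow> P (head G e)"
  shows "P v"
  using wf_arcs_ends
proof (induction v rule: wf_induct_rule)
  case (less v)
  show ?case
  proof (cases "in_degree G v = 0")
    case False
    then obtain e where "e \<in> arcs G" "head G e = v"
      by (auto simp: in_degree_eq_0_iff)
    with less assms(2) show ?thesis
      by (auto simp: arcs_ends_conv)
  qed (rule assms(1))
qed

text \<open>
  The universal property of the contraction map, in the form used to recognise a composition of two
  contraction maps as a single one.
\<close>

lemma contraction_map_eqI:
  assumes "\<And>r. in_degree G r = 0 \<Longrightarrow> f r = r"
    and "\<And>e. e \<in> arcs G \<Longrightarrow> f (head G e) = f (tail G e)"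
  shows "contraction_map G = f"
proof
  show "contraction_map G v = f v" for v
    by (induction v rule: forest_induct)
      (simp_all add: assms contraction_map_root contraction_map_arc)
qed

lemma in_degree_contraction_map: "in_degree G (contraction_map G v) = 0"
  by (induction v rule: forest_induct) (simp_all add: contraction_map_root contraction_map_arc)

lemma contraction_map_in_verts: "v \<in> verts G \<Longrightarrow> contraction_map G v \<in> verts G"
  by (induction v rule: forest_induct) (simp_all add: contraction_map_root contraction_map_arc)

text \<open>
  The connected component with root \<open>r\<close>, cut out as a fibre of the contraction map.
\<close>

definition component :: "'v \<Rightarrow> ('v, 'e) pre_digraph" where
  "component r =
     \<lparr> verts = {v \<in> verts G. contraction_map G v = r},
       arcs = {e \<in> arcs G. contraction_map G (head G e) = r},
       tail = tail G, head = head G \<rparr>"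

lemma component_sel [simp]:
  "verts (component r) = {v \<in> verts G. contraction_map G v = r}"
  "arcs (component r) = {e \<in> arcs G. contraction_map G (head G e) = r}"
  "tail (component r) = tail G" "head (component r) = head G"
  by (simp_all add: component_def)

lemma subgraph_component: "subgraph (component r) G"
proof -
  have "wf_digraph (component r)"
    by unfold_locales (auto simp: contraction_map_arc)
  then show ?thesis
    using wf_digraph by (auto simp: subgraph_def compatible_def)
qed

text \<open>
  Reachability is claimed inside the component, not just in \<open>G\<close>, since this is what makes the
  component connected as a graph of its own.
\<close>

lemma root_reaches:
  assumes "v \<in> verts G"
  shows "contraction_map G v \<rightarrow>\<^sup>*\<^bsub>with_proj (mk_symmetric (component (contraction_map G v)))\<^esub> v"
  using assms
proof (induction v rule: forest_induct)
  case (root r)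
  then show ?case
    by (simp add: contraction_map_root reachable_def)
next
  case (arc e)
  let ?c = "component (contraction_map G (tail G e))"
  have "(tail G e, head G e) \<in> parcs (mk_symmetric ?c)"
    using arc.hyps by (auto simp: parcs_mk_symmetric contraction_map_arc)
  moreover have "head G e \<in> verts ?c"
    using arc.hyps by (simp add: contraction_map_arc)
  moreover have "contraction_map G (tail G e) \<rightarrow>\<^sup>*\<^bsub>with_proj (mk_symmetric ?c)\<^esub> tail G e"
    using arc by simp
  ultimately show ?case
    using rtrancl_on_into_rtrancl_on[of "contraction_map G (tail G e)" "tail G e" "verts ?c"
        "parcs (mk_symmetric ?c)" "head G e"]
    by (simp add: contraction_map_arc[OF arc.hyps] reachable_def)
qed

text \<open>
  A vertex of the component other than \<open>r\<close> is moved by the contraction map, so it is not a root of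
  \<open>G\<close>; its unique incoming arc belongs to the component.
\<close>

lemma rooted_tree_component:
  assumes "r \<in> verts G" "in_degree G r = 0"
  shows "rooted_tree (component r)"
proof -
  interpret c: rooted_forest "component r"
    by (rule rooted_forest_subgraph[OF rooted_forest_axioms subgraph_component])
  interpret sym: pair_wf_digraph "mk_symmetric (component r)" ..
  have r: "r \<in> verts (component r)"
    using assms by (simp add: contraction_map_root)
  have reach: "r \<rightarrow>\<^sup>*\<^bsub>with_proj (mk_symmetric (component r))\<^esub> v" if "v \<in> verts (component r)" for v
    using root_reaches[of v] that by auto
  have "u \<rightarrow>\<^sup>*\<^bsub>with_proj (mk_symmetric (component r))\<^esub> v"
    if "u \<in> verts (component r)" "v \<in> verts (component r)" for u v
    using symmetric_reachable[OF symmetric_mk_symmetric reach[OF that(1)]] reach[OF that(2)]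
    by (rule sym.reachable_trans)
  then have "connected (component r)"
    using r unfolding connected_def strongly_connected_def by auto
  moreover have "in_degree (component r) r = 0"
    using assms(2) by (simp add: in_degree_eq_0_iff c.in_degree_eq_0_iff)
  moreover have "in_degree (component r) v = 1" if v: "v \<in> verts (component r)" "v \<noteq> r" for v
  proof -
    have "in_degree G v \<noteq> 0"
      using v contraction_map_root[of v] by auto
    then obtain e where e: "e \<in> arcs G" "head G e = v"
      by (auto simp: in_degree_eq_0_iff)
    with v have "in_arcs (component r) v = {e}"
      using parent_arc_unique by (auto simp: in_arcs_def)
    then show ?thesis
      by (simp add: in_degree_def)
  qed
  ultimately show ?thesis
    using r c.fin_digraph_axioms c.simply_connected
    unfolding rooted_tree_def by (intro conjI bexI[of _ r] ballI) simp_all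
qed

end

section \<open>Subforests are subgraphs\<close>

text \<open>
  A subgraph is the disjoint union of its connected components, which are rooted trees. This
  removes the quantifier over families of subtrees from all later arguments.
\<close>

lemma subforest_iff_subgraph:
  assumes "rooted_forest t"
  shows "subforest s t \<longleftrightarrow> subgraph s t"
proof
  interpret rooted_forest t by fact
  assume "subforest s t"
  then obtain C where C: "\<And>c. c \<in> C \<Longrightarrow> subgraph c t" and s: "s = pre_digraph.Union t C"
    by (auto simp: subforest_def subtree_def)
  have ends: "tail t e \<in> verts c \<and> head t e \<in> verts c" if "c \<in> C" "e \<in> arcs c" for c e
  proof -
    have "wf_digraph c" "tail c = tail t" "head c = head t"
      using C[OF that(1)] by (auto simp: subgraph_def compatible_def)
    then show ?thesis
      using wf_digraph.wellformed[OF _ that(2)] by simp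
  qed
  have "wf_digraph s"
    unfolding s Union_def by unfold_locales (use ends in fastforce)+
  moreover have "verts c \<subseteq> verts t" "arcs c \<subseteq> arcs t" if "c \<in> C" for c
    using C[OF that] by (simp_all add: subgraph_def)
  ultimately show "subgraph s t"
    using wf_digraph unfolding s subgraph_def compatible_def Union_def by (simp add: UN_least)
next
  assume st: "subgraph s t"
  interpret s: rooted_forest s
    by (rule rooted_forest_subgraph[OF assms st])
  let ?roots = "{r \<in> verts s. in_degree s r = 0}"
  let ?C = "s.component ` ?roots"
  have "subtree (s.component r) t" if "r \<in> ?roots" for r
    using that s.rooted_tree_component subgraph_trans[OF s.subgraph_component st]
    by (simp add: subtree_def)
  then have "\<forall>c\<in>?C. subtree c t"
    by blast
  moreover have "\<forall>c\<in>?C. \<forall>d\<in>?C. c \<noteq> d \<longrightarrow> verts c \<inter> verts d = {}"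
    by auto
  moreover have "s = pre_digraph.Union t ?C"
  proof (rule pre_digraph.equality)
    show "verts s = verts (pre_digraph.Union t ?C)"
      using s.in_degree_contraction_map s.contraction_map_in_verts
      by (simp add: pre_digraph.Union_def set_eq_iff) blast
    show "arcs s = arcs (pre_digraph.Union t ?C)"
      using s.in_degree_contraction_map s.contraction_map_in_verts[OF s.head_in_verts]
      by (simp add: pre_digraph.Union_def set_eq_iff) blast
  qed (use st in \<open>simp_all add: pre_digraph.Union_def subgraph_def compatible_def\<close>)
  ultimately show "subforest s t"
    unfolding subforest_def by (intro exI[of _ ?C] conjI)
qed

section \<open>Contracting twice\<close>

lemma arcs_subgraph_contract: "subgraph s' (contract t s) \<Longrightarrow> arcs s' \<subseteq> arcs t - arcs s"
  by (simp add: subgraph_def contract_def)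

lemma ends_subgraph_contract:
  assumes "subgraph s' (contract t s)" "e \<in> arcs s'"
  shows "tail s' e = contraction_map s (tail t e)" "head s' e = contraction_map s (head t e)"
proof -
  have "tail s' = tail (contract t s)" "head s' = head (contract t s)"
    using assms(1) by (simp_all add: subgraph_def compatible_def)
  moreover have "e \<in> arcs t - arcs s"
    using arcs_subgraph_contract[OF assms(1)] assms(2) by blast
  ultimately show "tail s' e = contraction_map s (tail t e)"
    "head s' e = contraction_map s (head t e)"
    by (simp_all add: contract_def)
qed

lemma subgraph_forest_union:
  assumes "subgraph s t" "subgraph s' (contract t s)"
  shows "subgraph (forest_union t s s') t"
proof -
  have sub: "verts s \<subseteq> verts t" "arcs s \<subseteq> arcs t" "tail s = tail t" "head s = head t"
    and wft: "wf_digraph t" and wfs: "wf_digraph s" and wfs': "wf_digraph s'"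
    using assms by (auto simp: subgraph_def compatible_def)
  note sub' = arcs_subgraph_contract[OF assms(2)]
  note ends = ends_subgraph_contract[OF assms(2)]
  have "wf_digraph (forest_union t s s')"
  proof
    fix e assume "e \<in> arcs (forest_union t s s')"
    then have e: "e \<in> arcs s \<or> e \<in> arcs s'"
      by (simp add: forest_union_def)
    then show "tail (forest_union t s s') e \<in> verts (forest_union t s s')"
      using wf_digraph.tail_in_verts[OF wfs, of e] wf_digraph.tail_in_verts[OF wfs', of e]
        wf_digraph.tail_in_verts[OF wft, of e] sub sub' ends
      by (auto simp: forest_union_def)
    from e show "head (forest_union t s s') e \<in> verts (forest_union t s s')"
      using wf_digraph.head_in_verts[OF wfs, of e] wf_digraph.head_in_verts[OF wfs', of e]
        wf_digraph.head_in_verts[OF wft, of e] sub sub' ends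
      by (auto simp: forest_union_def)
  qed
  with sub sub' wft show ?thesis
    by (auto simp: subgraph_def compatible_def forest_union_def)
qed

text \<open>
  The composition satisfies the universal property of the contraction map of \<open>s \<union> s'\<close>. Only its
  values at the roots need an argument.
\<close>

lemma contraction_map_forest_union:
  assumes "rooted_forest t" "rooted_forest (contract t s)"
    and "subgraph s t" "subgraph s' (contract t s)"
  shows "contraction_map (forest_union t s s') = contraction_map s' \<circ> contraction_map s"
proof -
  interpret t: rooted_forest t by fact
  interpret s: rooted_forest s
    by (rule rooted_forest_subgraph) fact+
  interpret s': rooted_forest s'
    by (rule rooted_forest_subgraph) fact+
  interpret u: rooted_forest "forest_union t s s'"
    by (rule rooted_forest_subgraph[OF assms(1) subgraph_forest_union]) fact+
  have sub: "arcs s \<subseteq> arcs t" "tail s = tail t" "head s = head t"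
    using assms(3) by (auto simp: subgraph_def compatible_def)
  note sub' = arcs_subgraph_contract[OF assms(4)]
  note ends = ends_subgraph_contract[OF assms(4)]
  show ?thesis
  proof (rule u.contraction_map_eqI)
    fix r assume "in_degree (forest_union t s s') r = 0"
    then have r: "\<And>e. e \<in> arcs s \<Longrightarrow> head t e \<noteq> r" "\<And>e. e \<in> arcs s' \<Longrightarrow> head t e \<noteq> r"
      unfolding u.in_degree_eq_0_iff by (auto simp: forest_union_def)
    \<comment> \<open>Otherwise \<open>e\<close> enters, in \<open>t\<close>, a vertex other than \<open>r\<close> of the \<open>s\<close>-component of \<open>r\<close>, which also
      has an incoming arc in \<open>s\<close>. The two arcs coincide, but \<open>e\<close> is not an arc of \<open>s\<close>.\<close>
    have "head s' e \<noteq> r" if e: "e \<in> arcs s'" for e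
    proof
      assume "head s' e = r"
      then have cm: "contraction_map s (head t e) = r"
        using ends e by simp
      then have "contraction_map s (head t e) \<noteq> head t e"
        using r(2)[OF e] by simp
      then have "in_degree s (head t e) \<noteq> 0"
        using s.contraction_map_root by blast
      then obtain a where "a \<in> arcs s" "head t a = head t e"
        using sub by (auto simp: s.in_degree_eq_0_iff)
      then show False
        using t.parent_arc_unique[of a e] e sub sub' by auto
    qed
    then have "in_degree s r = 0" "in_degree s' r = 0"
      using r sub by (auto simp: s.in_degree_eq_0_iff s'.in_degree_eq_0_iff)
    then show "(contraction_map s' \<circ> contraction_map s) r = r"
      by (simp add: s.contraction_map_root s'.contraction_map_root)
  next
    fix e assume "e \<in> arcs (forest_union t s s')"
    then consider "e \<in> arcs s" | "e \<in> arcs s'" by (auto simp: forest_union_def)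
    then show "(contraction_map s' \<circ> contraction_map s) (head (forest_union t s s') e) =
        (contraction_map s' \<circ> contraction_map s) (tail (forest_union t s s') e)"
    proof cases
      case 1
      then show ?thesis
        using s.contraction_map_arc[of e] sub by (simp add: forest_union_def)
    next
      case 2
      then show ?thesis
        using s'.contraction_map_arc[of e] ends by (simp add: forest_union_def)
    qed
  qed
qed

lemma contract_contract:
  assumes "rooted_forest t" "rooted_forest (contract t s)"
    and "subgraph s t" "subgraph s' (contract t s)"
  shows "contract (contract t s) s' = contract t (forest_union t s s')"
  using contraction_map_forest_union[OF assms]
  by (auto simp: contract_def forest_union_def image_comp Diff_Un fun_eq_iff restrict_def)

lemma forest_union_assoc:
  assumes "rooted_forest t" "rooted_forest (contract t s)"
    and "subgraph s t" "subgraph s' (contract t s)"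
  shows "forest_union t (forest_union t s s') s'' =
    forest_union t s (forest_union (contract t s) s' s'')"
  using contraction_map_forest_union[OF assms]
  by (auto simp: forest_union_def contract_def)

section \<open>Bilinear extension\<close>

lemma sharp_sum_left: "(\<Sum>i\<in>I. f i) \<sharp> y = (\<Sum>i\<in>I. f i \<sharp> y)"
  by (induction I rule: infinite_finite_induct) (simp_all add: sharp_add_left, simp_all add: sharp_def)

lemma sharp_sum_right: "x \<sharp> (\<Sum>i\<in>I. f i) = (\<Sum>i\<in>I. x \<sharp> f i)"
  by (induction I rule: infinite_finite_induct) (simp_all add: sharp_add_right, simp_all add: sharp_def)

lemma sharp_single: "Poly_Mapping.single a k \<sharp> Poly_Mapping.single b l = sharp_basis a b (k * l)"
  by (simp add: sharp_def)

lemma sum_singles: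
  "(\<Sum>a\<in>Poly_Mapping.keys x. Poly_Mapping.single a (Poly_Mapping.lookup x a)) = x"
  by (rule poly_mapping_eqI) (auto simp: lookup_sum lookup_single when_def sum.delta' in_keys_iff)

text \<open>
  What the closure of \<open>T\<close> under contraction provides, with the couple of empty graphs treated on the
  same footing as the couples of trees. For a tree \<open>t\<close> it is this closure that makes \<open>t/s\<close>
  a tree, so that the results on forests apply to the subforests of \<open>t/s\<close> too.
\<close>

lemma couples_rooted_forest:
  assumes "contraction_closed T" "(t, s) \<in> couples T"
  shows "rooted_forest t" "rooted_forest (contract t s)" "subgraph s t"
proof -
  show t: "rooted_forest t"
    using assms rooted_forest_if_rooted_tree rooted_forest_empty_graph
    by (auto simp: couples_def contraction_closed_def)
  show s: "subgraph s t"
    using assms subforest_iff_subgraph[OF t] by (auto simp: couples_def)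
  show "rooted_forest (contract t s)"
  proof (cases "t = empty_graph")
    case True
    with s have "contract t s = empty_graph"
      by (auto simp: contract_def subgraph_def empty_graph_def)
    then show ?thesis
      by (simp add: rooted_forest_empty_graph)
  next
    case False
    with assms show ?thesis
      by (auto simp: couples_def contraction_closed_def intro: rooted_forest_if_rooted_tree)
  qed
qed

lemma forest_union_in_couples:
  assumes "contraction_closed T" "(t, s) \<in> couples T" "(contract t s, s') \<in> couples T"
  shows "(t, forest_union t s s') \<in> couples T"
  using assms(2) couples_rooted_forest[OF assms(1,2)] couples_rooted_forest[OF assms(1,3)]
  by (simp add: couples_def subforest_iff_subgraph subgraph_forest_union)

lemma V_tilde_sum: "(\<And>i. i \<in> I \<Longrightarrow> f i \<in> V_tilde T) \<Longrightarrow> (\<Sum>i\<in>I. f i) \<in> V_tilde T"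
  using order_trans[OF Poly_Mapping.keys_sum UN_least, of I f "couples T"]
  by (simp add: V_tilde_def)

lemma sharp_in_V_tilde:
  assumes "contraction_closed T" "x \<in> V_tilde T" "y \<in> V_tilde T"
  shows "x \<sharp> y \<in> V_tilde T"
  unfolding sharp_def
proof (intro V_tilde_sum)
  fix a b
  assume "a \<in> Poly_Mapping.keys x" "b \<in> Poly_Mapping.keys y"
  with assms(2,3) have "a \<in> couples T" "b \<in> couples T"
    by (auto simp: V_tilde_def)
  then show "sharp_basis a b (Poly_Mapping.lookup x a * Poly_Mapping.lookup y b) \<in> V_tilde T"
    using forest_union_in_couples[OF assms(1)]
    by (auto simp: sharp_basis_def V_tilde_def split: prod.split)
qed

lemma sharp_assoc_single:
  fixes k l m :: "'k::field"
  assumes "contraction_closed T" "a \<in> couples T" "b \<in> couples T"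
  shows "(Poly_Mapping.single a k \<sharp> Poly_Mapping.single b l) \<sharp> Poly_Mapping.single c m =
    Poly_Mapping.single a k \<sharp> (Poly_Mapping.single b l \<sharp> Poly_Mapping.single c m)"
proof -
  obtain t s t' s' t'' s'' where abc: "a = (t, s)" "b = (t', s')" "c = (t'', s'')"
    by (metis prod.exhaust)
  show ?thesis
  proof (cases "t' = contract t s")
    case True
    note ts = couples_rooted_forest[OF assms(1) assms(2)[unfolded abc]]
    have s': "subgraph s' (contract t s)"
      using couples_rooted_forest[OF assms(1) assms(3)[unfolded abc]] True by simp
    show ?thesis
      using contract_contract[OF ts s'] forest_union_assoc[OF ts s']
      by (auto simp: abc True sharp_single sharp_basis_def sharp_def[of 0] sharp_def[of _ 0] mult.assoc)
  next
    case False
    then show ?thesis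
      by (auto simp: abc sharp_single sharp_basis_def sharp_def[of 0] sharp_def[of _ 0])
  qed
qed

lemma sharp_assoc:
  fixes x y z :: "('v, 'e) couple \<Rightarrow>\<^sub>0 'k::field"
  assumes "contraction_closed T" "x \<in> V_tilde T" "y \<in> V_tilde T"
  shows "(x \<sharp> y) \<sharp> z = x \<sharp> (y \<sharp> z)"
proof -
  let ?m = "\<lambda>w a. Poly_Mapping.single a (Poly_Mapping.lookup w a)"
  let ?X = "Poly_Mapping.keys x" and ?Y = "Poly_Mapping.keys y" and ?Z = "Poly_Mapping.keys z"
  have "((\<Sum>a\<in>?X. ?m x a) \<sharp> (\<Sum>b\<in>?Y. ?m y b)) \<sharp> (\<Sum>c\<in>?Z. ?m z c) =
      (\<Sum>a\<in>?X. \<Sum>b\<in>?Y. \<Sum>c\<in>?Z. (?m x a \<sharp> ?m y b) \<sharp> ?m z c)"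
    by (simp only: sharp_sum_left, simp only: sharp_sum_right sharp_sum_left,
        rule sum.cong[OF refl sum.swap])
  also have "\<dots> = (\<Sum>a\<in>?X. \<Sum>b\<in>?Y. \<Sum>c\<in>?Z. ?m x a \<sharp> (?m y b \<sharp> ?m z c))"
    using assms(2,3) by (intro sum.cong refl sharp_assoc_single[OF assms(1)]) (auto simp: V_tilde_def)
  also have "\<dots> = (\<Sum>a\<in>?X. ?m x a) \<sharp> ((\<Sum>b\<in>?Y. ?m y b) \<sharp> (\<Sum>c\<in>?Z. ?m z c))"
    by (simp only: sharp_sum_left) (simp only: sharp_sum_right sharp_sum_left)
  finally show ?thesis
    by (simp only: sum_singles)
qed

theorem theorem6:
  fixes T :: "('v, 'e) pre_digraph set"
  assumes "contraction_closed T"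
  shows "(\<forall>x\<in>V_tilde T. \<forall>y\<in>V_tilde T. x \<sharp> y \<in> (V_tilde T :: (('v, 'e) couple \<Rightarrow>\<^sub>0 'k::field) set)) \<and>
    (\<forall>x\<in>(V_tilde T :: (('v, 'e) couple \<Rightarrow>\<^sub>0 'k) set). \<forall>y\<in>V_tilde T. \<forall>z\<in>V_tilde T.
       (x \<sharp> y) \<sharp> z = x \<sharp> (y \<sharp> z))"
  using sharp_in_V_tilde[OF assms] sharp_assoc[OF assms] by blast

end
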